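(* For all integers $r\ge 1$ and all $(\alpha;\beta)=(\alpha_1,\dots,\alpha_{r+1};\beta_1,\dots,\beta_r)\in\mathcal{U}_r$ for which no $\beta_i+1$ is a non-positive integer, $$ {}_{r+1}F_r\left(\begin{array}{c}\alpha_1,\,\ldots,\,\alpha_{r+1}\\ \beta_1+1,\,\ldots,\,\beta_r+1\end{array}\middle| x\right) =(1-x)\; {}_{r+1}F_r\left(\begin{array}{c}\alpha_1+1,\,\ldots,\,\alpha_{r+1}+1\\ \beta_1+1,\,\ldots,\,\beta_r+1\end{array}\middle| x\right). $$
   Context: For complex parameters with no lower parameter a non-positive integer, ${}_{r+1}F_r\left(\begin{array}{c}a_1,\ldots,a_{r+1}\\ b_1,\ldots,b_r\end{array}\middle| x\right)=\sum_{k\ge0}\frac{(a_1)_k\cdots(a_{r+1})_k}{(b_1)_k\cdots(b_r)_k}\frac{x^k}{k!}$, where $(a)_k=a(a+1)\cdots(a+k-1)$ and $(a)_0=1$. The series converges absolutely for $|x|<1$ and continues uniquely from the unit disk to $\mathbb{CP}^1\setminus[1,\infty]$. A transformation formula stated without restriction on $x$ is understood to hold in the largest neighborhood of $x=0$ in $\mathbb{CP}^1\setminus[1,\infty]$ to which both sides can be continued. For each $r\ge1$, $\mathcal{U}_r\subset\mathbb{C}^{r+1}\times\mathbb{C}^r$ is the set of all $(\alpha;\beta)$ satisfying the $r$ equations $S_k(\alpha)=S_k(\beta)$, $k=1,\dots,r$, where $S_k(\alpha)$ and $S_k(\beta)$ are the $k$-th elementary symmetric polynomials in $\alpha_1,\dots,\alpha_{r+1}$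 and in $\beta_1,\dots,\beta_r$, respectively. *)

theory Defs
  imports "HOL-Complex_Analysis.Complex_Analysis"
begin

text \<open>
  The Riemann sphere minus the closed interval from \<open>1\<close> to \<open>\<infinity>\<close> along the real axis.
  The removed interval contains \<open>\<infinity>\<close>, so this is a subset of the complex plane.
\<close>
definition slit_plane :: "complex set" where
  "slit_plane = UNIV - complex_of_real ` {1..}"

text \<open>
  The generalised hypergeometric function, continued from the unit disk to the slit plane.
  The scaling parameter \<open>1\<close> of \<^const>\<open>fps_hypergeo\<close> gives the series
  \<open>\<Sum>k. (a\<^sub>1)\<^sub>k \<cdots> (a\<^sub>p)\<^sub>k / ((b\<^sub>1)\<^sub>k \<cdots> (b\<^sub>q)\<^sub>k k!) x\<^sup>k\<close>.
  The definition is meaningful when \<open>length as = length bs + 1\<close> and no entry of \<open>bs\<close> is a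
  non-positive integer; by the identity theorem the continuation is then unique on
  \<^const>\<open>slit_plane\<close>. Values outside the slit plane are unspecified.
\<close>
definition hypergeo_F :: "complex list \<Rightarrow> complex list \<Rightarrow> complex \<Rightarrow> complex" where
  "hypergeo_F as bs =
     (SOME f. f holomorphic_on slit_plane \<and>
              (\<forall>x. norm x < 1 \<longrightarrow> f x = eval_fps (fps_hypergeo as bs 1) x))"

definition elem_sym :: "nat \<Rightarrow> complex list \<Rightarrow> complex" where
  "elem_sym k xs = (\<Sum>I | I \<subseteq> {..<length xs} \<and> card I = k. \<Prod>i\<in>I. xs ! i)"

definition U_set :: "nat \<Rightarrow> (complex list \<times> complex list) set" where
  "U_set r = {(\<alpha>, \<beta>). length \<alpha> = r + 1 \<and> length \<beta> = r \<and>
                       (\<forall>k\<in>{1..r}. elem_sym k \<alpha> = elem_sym k \<beta>)}"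

end

theory Submission
  imports Defs
begin

text \<open>
  On the level of power series the identity is a telescoping coefficient comparison: membership
  in \<open>U\<^sub>r\<close> says that \<open>\<Prod>(t + \<alpha>\<^sub>i) = t \<Prod>(t + \<beta>\<^sub>i) + \<Prod>\<alpha>\<^sub>i\<close> for all \<open>t\<close>. The remaining point is that the
  series do continue to the slit plane. This holds because the Hadamard multiplier
  \<open>(a)\<^sub>k / (b)\<^sub>k\<close> preserves the series with such a continuation: after shifting the parameters it is
  a constant multiple of the moment \<open>\<integral> t\<^sup>k t\<^sup>a\<^sup>-\<^sup>1 (1 - t)\<^sup>b\<^sup>-\<^sup>a\<^sup>-\<^sup>1 dt\<close> over \<open>[0, 1]\<close>, and the slit plane
  is star-shaped about \<open>0\<close>, so that \<open>\<integral> f(t x) w(t) dt\<close> is holomorphic there whenever \<open>f\<close> is.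
\<close>

section \<open>Continuation to the slit plane\<close>

lemma open_slit_plane: "open slit_plane"
proof -
  have "closed (complex_of_real ` {1..})"
    by (intro closed_injective_linear_image)
      (auto simp: inj_def intro: bounded_linear.linear bounded_linear_of_real)
  then show ?thesis by (auto simp: slit_plane_def open_Diff)
qed

lemma connected_slit_plane: "connected slit_plane"
  using starlike_imp_connected[OF starlike_slotted_complex_plane_right[of 1]]
  by (simp add: slit_plane_def Compl_eq_Diff_UNIV)

lemma slit_plane_iff: "z \<in> slit_plane \<longleftrightarrow> Im z \<noteq> 0 \<or> Re z < 1"
  by (auto simp: slit_plane_def complex_eq_iff image_iff not_le)

lemma unit_ball_subset_slit_plane: "ball 0 1 \<subseteq> slit_plane"
  by (auto simp: slit_plane_iff intro: le_less_trans[OF complex_Re_le_cmod])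

lemma scale_in_slit_plane:
  assumes "z \<in> slit_plane" "t \<in> {0..1}"
  shows "of_real t * z \<in> slit_plane"
proof -
  have "t * Re z < 1" if "Re z < 1"
  proof (cases "t = 0")
    case False
    then have "t * Re z < t * 1" using that assms by (intro mult_strict_left_mono) auto
    then show ?thesis using assms by auto
  qed auto
  then show ?thesis using assms by (auto simp: slit_plane_iff)
qed

text \<open>The expansion is prescribed only at 0. Since the open unit disk lies in the slit plane,
  holomorphy forces the series to converge to f on the whole disk, so radii of convergence need no
  separate bookkeeping.\<close>

definition slit_continuable :: "complex fps \<Rightarrow> bool" where
  "slit_continuable F \<longleftrightarrow> (\<exists>f. f holomorphic_on slit_plane \<and> f has_fps_expansion F)"

lemma zero_in_slit_plane: "0 \<in> slit_plane"
  by (simp add: slit_plane_iff)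

text \<open>The identity theorem turns the defining property of \<open>hypergeo_F\<close> into
  equality with one known continuation g. One direction provides a witness for the choice in
  \<open>hypergeo_F\<close>, the other identifies the chosen function with g.\<close>

lemma has_fps_expansion_iff_unit_ball:
  assumes "f holomorphic_on slit_plane" "g has_fps_expansion F" "g holomorphic_on slit_plane"
  shows "(\<forall>x. norm x < 1 \<longrightarrow> f x = eval_fps F x) \<longleftrightarrow> (\<forall>x\<in>slit_plane. f x = g x)"
proof -
  have g: "eval_fps F x = g x" if "norm x < 1" for x
    using assms(2) that holomorphic_on_subset[OF assms(3) unit_ball_subset_slit_plane]
    by (rule has_fps_expansion_imp_eval_fps_eq)
  show ?thesis
  proof
    assume *: "\<forall>x. norm x < 1 \<longrightarrow> f x = eval_fps F x"
    show "\<forall>x\<in>slit_plane. f x = g x"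
    proof
      fix x assume x: "x \<in> slit_plane"
      show "f x = g x"
        by (rule analytic_continuation_open[of "ball 0 1" slit_plane])
          (use assms x * g open_slit_plane connected_slit_plane unit_ball_subset_slit_plane in auto)
    qed
  next
    assume "\<forall>x\<in>slit_plane. f x = g x"
    then show "\<forall>x. norm x < 1 \<longrightarrow> f x = eval_fps F x"
      using g unit_ball_subset_slit_plane by auto
  qed
qed

lemma hypergeo_F_eqI:
  assumes "f holomorphic_on slit_plane" "f has_fps_expansion fps_hypergeo as bs 1" "x \<in> slit_plane"
  shows "hypergeo_F as bs x = f x"
proof -
  let ?P = "\<lambda>g. g holomorphic_on slit_plane \<and>
              (\<forall>x. norm x < 1 \<longrightarrow> g x = eval_fps (fps_hypergeo as bs 1) x)"
  have "?P f" using has_fps_expansion_iff_unit_ball[OF assms(1,2,1)] assms(1) by auto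
  then have "?P (hypergeo_F as bs)" unfolding hypergeo_F_def by (rule someI[of ?P])
  then show ?thesis using has_fps_expansion_iff_unit_ball[OF _ assms(2,1)] assms(3) by blast
qed

section \<open>Operations on series that preserve continuability\<close>

lemma slit_continuable_geometric: "slit_continuable (Abs_fps (\<lambda>_. 1))"
proof -
  have "(\<lambda>x. inverse (1 - x)) holomorphic_on slit_plane"
    by (intro holomorphic_intros) (auto simp: slit_plane_iff)
  moreover have "(\<lambda>x::complex. inverse (1 - x)) has_fps_expansion inverse (1 - fps_X)"
    by (intro fps_expansion_intros) auto
  moreover have "inverse (1 - fps_X) = (Abs_fps (\<lambda>_. 1) :: complex fps)"
    by (metis fps_inverse_gp' fps_inverse_idempotent fps_nth_Abs_fps zero_neq_one)
  ultimately show ?thesis unfolding slit_continuable_def by metis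
qed

lemma slit_continuable_const_mult:
  assumes "slit_continuable F"
  shows "slit_continuable (fps_const c * F)"
proof -
  obtain f where "f holomorphic_on slit_plane" "f has_fps_expansion F"
    using assms by (auto simp: slit_continuable_def)
  then have "(\<lambda>x. c * f x) holomorphic_on slit_plane \<and>
      (\<lambda>x. c * f x) has_fps_expansion fps_const c * F"
    by (intro conjI holomorphic_intros fps_expansion_intros)
  then show ?thesis unfolding slit_continuable_def by blast
qed

text \<open>The operator x d/dx + b multiplies x^k by k + b. It serves to pass from a denominator
  parameter b + 1 to b.\<close>

lemma slit_continuable_Euler_operator:
  assumes "slit_continuable F"
  shows "slit_continuable (Abs_fps (\<lambda>k. (of_nat k + b) * F $ k))"
proof -
  obtain f where f: "f holomorphic_on slit_plane" "f has_fps_expansion F"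
    using assms by (auto simp: slit_continuable_def)
  have "(\<lambda>x. x * deriv f x + b * f x) has_fps_expansion fps_X * fps_deriv F + fps_const b * F"
    by (intro fps_expansion_intros f)
  moreover have "(\<lambda>x. x * deriv f x + b * f x) holomorphic_on slit_plane"
    by (intro holomorphic_intros f open_slit_plane)
  moreover have "fps_X * fps_deriv F + fps_const b * F = Abs_fps (\<lambda>k. (of_nat k + b) * F $ k)"
  proof (rule fps_ext)
    fix k
    show "(fps_X * fps_deriv F + fps_const b * F) $ k = Abs_fps (\<lambda>k. (of_nat k + b) * F $ k) $ k"
      by (cases k) (simp_all add: distrib_right del: of_nat_Suc)
  qed
  ultimately show ?thesis unfolding slit_continuable_def by auto
qed

lemma slit_continuable_shift:
  assumes "slit_continuable F"
  shows "slit_continuable (fps_shift 1 F)"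
proof -
  obtain f where f: "f holomorphic_on slit_plane" "f has_fps_expansion F"
    using assms by (auto simp: slit_continuable_def)
  \<comment> \<open>The difference quotient has a removable singularity at 0, filled by the value
    \<open>deriv f 0\<close>.\<close>
  let ?g = "\<lambda>z. if z = 0 then deriv f 0 else (f z - f 0) / (z - 0)"
  have g: "?g holomorphic_on slit_plane"
    by (intro pole_lemma_open f open_slit_plane)
  have exp: "?g has_fps_expansion fps_expansion ?g 0"
    by (rule has_fps_expansion_fps_expansion[OF open_slit_plane zero_in_slit_plane g])
  then have "(\<lambda>z. f 0 + z * ?g z) has_fps_expansion fps_const (f 0) + fps_X * fps_expansion ?g 0"
    by (intro fps_expansion_intros)
  moreover have "(\<lambda>z. f 0 + z * ?g z) = f" by auto
  ultimately have "F = fps_const (f 0) + fps_X * fps_expansion ?g 0"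
    using fps_expansion_unique_complex f(2) by metis
  then have "fps_shift 1 F = fps_expansion ?g 0"
    by (simp add: fps_eq_iff)
  then show ?thesis using g exp unfolding slit_continuable_def by metis
qed

lemma slit_continuable_unshift:
  assumes "slit_continuable F"
  shows "slit_continuable (fps_const c + fps_X * F)"
proof -
  obtain f where "f holomorphic_on slit_plane" "f has_fps_expansion F"
    using assms by (auto simp: slit_continuable_def)
  then have "(\<lambda>x. c + x * f x) holomorphic_on slit_plane \<and>
      (\<lambda>x. c + x * f x) has_fps_expansion fps_const c + fps_X * F"
    by (intro conjI holomorphic_intros fps_expansion_intros)
  then show ?thesis unfolding slit_continuable_def by blast
qed

section \<open>Moment multipliers\<close>

text \<open>Differentiation under the integral sign: the segments from 0 to a small ball around x
  stay in the slit plane. The derivative has the same shape, with \<open>deriv f\<close> and the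
  weight t w(t), so the rule can be iterated.\<close>

lemma has_field_derivative_scaled_integral:
  fixes w :: "real \<Rightarrow> complex"
  assumes f: "f holomorphic_on slit_plane" and w: "continuous_on {0..1} w" and x: "x \<in> slit_plane"
  shows "((\<lambda>x. integral {0..1} (\<lambda>t. f (of_real t * x) * w t)) has_field_derivative
           integral {0..1} (\<lambda>t. deriv f (of_real t * x) * (of_real t * w t))) (at x)"
proof -
  obtain e where e: "e > 0" "ball x e \<subseteq> slit_plane"
    using x open_slit_plane by (auto simp: open_contains_ball)
  have sc: "of_real t * z \<in> slit_plane" if "z \<in> ball x e" "t \<in> {0..1}" for z t
    using scale_in_slit_plane e that by blast
  have df: "deriv f holomorphic_on slit_plane"
    by (intro holomorphic_deriv f open_slit_plane)
  have "((\<lambda>x. integral (cbox 0 1) (\<lambda>t. f (of_real t * x) * w t)) has_field_derivative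
          integral (cbox 0 1) (\<lambda>t. deriv f (of_real t * x) * (of_real t * w t))) (at x within ball x e)"
  proof (rule leibniz_rule_field_derivative)
    fix z t assume zt: "z \<in> ball x e" "t \<in> cbox 0 (1::real)"
    have "(f has_field_derivative deriv f (of_real t * z)) (at (of_real t * z))"
      using sc[of z t] zt by (intro holomorphic_derivI[OF f open_slit_plane]) auto
    then have "((\<lambda>z. f (of_real t * z)) has_field_derivative deriv f (of_real t * z) * of_real t)
        (at z within ball x e)"
      by (rule DERIV_chain2[where g = "\<lambda>z. of_real t * z"]) (auto intro!: derivative_eq_intros)
    then show "((\<lambda>z. f (of_real t * z) * w t) has_field_derivative
             deriv f (of_real t * z) * (of_real t * w t)) (at z within ball x e)"
      by (auto intro!: derivative_eq_intros)
  next
    fix z assume z: "z \<in> ball x e"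
    have "continuous_on {0..1} (\<lambda>t. f (of_real t * z))"
      by (rule continuous_on_compose2[OF holomorphic_on_imp_continuous_on[OF f]])
        (use sc z in \<open>auto intro!: continuous_intros\<close>)
    then show "(\<lambda>t. f (of_real t * z) * w t) integrable_on cbox 0 1"
      by (auto intro!: integrable_continuous_real continuous_intros w)
  next
    have "continuous_on (ball x e \<times> {0..1}) (\<lambda>p. deriv f (of_real (snd p) * fst p))"
      by (rule continuous_on_compose2[OF holomorphic_on_imp_continuous_on[OF df]])
        (use sc in \<open>auto intro!: continuous_intros\<close>)
    moreover have "continuous_on (ball x e \<times> {0..1}) (\<lambda>p. w (snd p))"
      by (rule continuous_on_compose2[OF w]) (auto intro!: continuous_intros)
    ultimately show "continuous_on (ball x e \<times> cbox 0 1)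
        (\<lambda>(z, t). deriv f (of_real t * z) * (of_real t * w t))"
      by (auto simp: case_prod_unfold intro!: continuous_intros)
  qed (use e in auto)
  then show ?thesis using e by (simp add: at_within_open[of x "ball x e"])
qed

lemma scaled_integral_holomorphic:
  assumes "f holomorphic_on slit_plane" "continuous_on {0..1} w"
  shows "(\<lambda>x. integral {0..1} (\<lambda>t. f (of_real t * x) * w t)) holomorphic_on slit_plane"
  using has_field_derivative_scaled_integral[OF assms] open_slit_plane
  by (auto simp: holomorphic_on_open)

lemma higher_deriv_scaled_integral:
  assumes "f holomorphic_on slit_plane" "continuous_on {0..1} w" "x \<in> slit_plane"
  shows "(deriv ^^ n) (\<lambda>x. integral {0..1} (\<lambda>t. f (of_real t * x) * w t)) x =
           integral {0..1} (\<lambda>t. (deriv ^^ n) f (of_real t * x) * (of_real t ^ n * w t))"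
  using assms(3)
proof (induction n arbitrary: x)
  case (Suc n)
  let ?F = "\<lambda>x. integral {0..1} (\<lambda>t. f (of_real t * x) * w t)"
  let ?G = "\<lambda>x. integral {0..1} (\<lambda>t. (deriv ^^ n) f (of_real t * x) * (of_real t ^ n * w t))"
  have "(?G has_field_derivative integral {0..1} (\<lambda>t. deriv ((deriv ^^ n) f) (of_real t * x) *
      (of_real t * (of_real t ^ n * w t)))) (at x)"
    by (intro has_field_derivative_scaled_integral holomorphic_higher_deriv assms(1) Suc.prems
        open_slit_plane continuous_intros assms(2))
  \<comment> \<open>Differentiating the induction hypothesis requires it near x and not only at x;
    openness of the slit plane provides this.\<close>
  moreover have "deriv ((deriv ^^ n) ?F) x = deriv ?G x"
  proof (rule deriv_cong_ev)
    show "\<forall>\<^sub>F x in nhds x. (deriv ^^ n) ?F x = ?G x"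
      using eventually_nhds_in_open[OF open_slit_plane Suc.prems]
      by eventually_elim (rule Suc.IH)
  qed auto
  ultimately show ?case by (simp add: DERIV_imp_deriv mult_ac)
qed auto

text \<open>At x = 0 the k-th derivative of the integral of f(t x) w(t) splits into the k-th
  derivative of f at 0 and the k-th moment of w.\<close>

lemma slit_continuable_moment_multiplier:
  fixes w :: "real \<Rightarrow> complex"
  assumes "slit_continuable F" and w: "continuous_on {0..1} w"
  shows "slit_continuable (Abs_fps (\<lambda>k. F $ k * integral {0..1} (\<lambda>t. of_real t ^ k * w t)))"
proof -
  obtain f where f: "f holomorphic_on slit_plane" "f has_fps_expansion F"
    using assms by (auto simp: slit_continuable_def)
  let ?G = "\<lambda>x. integral {0..1} (\<lambda>t. f (of_real t * x) * w t)"
  have G: "?G holomorphic_on slit_plane"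
    by (intro scaled_integral_holomorphic f w)
  have F: "F = fps_expansion f 0"
    using fps_expansion_eqI[OF f(2)] by simp
  have "fps_expansion ?G 0 = Abs_fps (\<lambda>k. F $ k * integral {0..1} (\<lambda>t. of_real t ^ k * w t))"
    using higher_deriv_scaled_integral[OF f(1) w zero_in_slit_plane]
    by (simp add: fps_eq_iff F fps_expansion_def)
  then have "?G has_fps_expansion Abs_fps (\<lambda>k. F $ k * integral {0..1} (\<lambda>t. of_real t ^ k * w t))"
    using has_fps_expansion_fps_expansion[OF open_slit_plane zero_in_slit_plane G] by simp
  with G show ?thesis unfolding slit_continuable_def by blast
qed

section \<open>A continuous function on an interval is determined by its moments\<close>

lemma vanishing_moments_imp_zero_real:
  fixes u :: "real \<Rightarrow> real"
  assumes u: "continuous_on {a..b} u" and "a < b"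
    and mom: "\<And>k. integral {a..b} (\<lambda>t. t ^ k * u t) = 0" and "t \<in> {a..b}"
  shows "u t = 0"
proof -
  have "compact (u ` {a..b})" using u by (intro compact_continuous_image) auto
  then obtain M where M: "M > 0" "\<And>t. t \<in> {a..b} \<Longrightarrow> \<bar>u t\<bar> \<le> M"
    using compact_imp_bounded bounded_pos by (metis imageI real_norm_def)
  \<comment> \<open>Vanishing moments make u orthogonal to every polynomial p, so the integral of
    u^2 equals that of u (u - p). If p approximates u within d, this is at most d M (b - a), and d
    is chosen to make that bound e.\<close>
  have "integral {a..b} (\<lambda>t. u t * u t) \<le> 0 + e" if "e > 0" for e
  proof -
    define d where "d = e / (M * (b - a))"
    have d: "d > 0" using that M assms by (simp add: d_def)
    obtain p where p: "polynomial_function p" "\<And>t. t \<in> {a..b} \<Longrightarrow> norm (u t - p t) < d"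
      using Stone_Weierstrass_polynomial_function[OF compact_Icc u d] by blast
    then obtain c n where pc: "p = (\<lambda>x. \<Sum>i\<le>n. c i * x ^ i)"
      using real_polynomial_function_iff_sum[of p] by (auto simp: real_polynomial_function_eq)
    have "(\<lambda>t. t ^ i * u t) integrable_on {a..b}" for i
      by (intro integrable_continuous_real continuous_intros u)
    then have "((\<lambda>t. t ^ i * u t) has_integral 0) {a..b}" for i
      by (simp add: has_integral_iff mom)
    then have "((\<lambda>t. \<Sum>i\<le>n. c i * (t ^ i * u t)) has_integral (\<Sum>i\<le>n. c i * 0)) {a..b}"
      by (intro has_integral_sum has_integral_mult_right) auto
    then have 1: "((\<lambda>t. p t * u t) has_integral 0) {a..b}"
      by (simp add: pc sum_distrib_right mult.assoc)
    have 2: "((\<lambda>t. u t * u t) has_integral integral {a..b} (\<lambda>t. u t * u t)) {a..b}"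
      by (intro integrable_integral integrable_continuous_real continuous_intros u)
    have "integral {a..b} (\<lambda>t. u t * u t) - 0 \<le> d * M * (b - a)"
    proof (rule has_integral_le[OF has_integral_diff[OF 2 1]])
      show "((\<lambda>_. d * M) has_integral d * M * (b - a)) {a..b}"
        using has_integral_const_real[of "d * M" a b] \<open>a < b\<close> by (simp add: mult_ac)
      fix t assume t: "t \<in> {a..b}"
      have "u t * u t - p t * u t \<le> \<bar>u t - p t\<bar> * \<bar>u t\<bar>"
        by (simp add: algebra_simps flip: abs_mult)
      also have "\<dots> \<le> d * M" using p(2)[OF t] M t by (intro mult_mono) auto
      finally show "u t * u t - p t * u t \<le> d * M" .
    qed
    also have "d * M * (b - a) = e" using M \<open>a < b\<close> by (simp add: d_def)
    finally show ?thesis by simp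
  qed
  then have "integral {a..b} (\<lambda>t. u t * u t) \<le> 0" by (rule field_le_epsilon)
  moreover have "integral {a..b} (\<lambda>t. u t * u t) \<ge> 0"
    by (intro integral_nonneg integrable_continuous_real continuous_intros u) auto
  ultimately have "integral {a..b} (\<lambda>t. u t * u t) = 0" by linarith
  moreover have "continuous_on {a..b} (\<lambda>t. u t * u t)"
    by (intro continuous_intros u)
  ultimately have "\<forall>t\<in>{a..b}. u t * u t = 0"
    using integral_eq_0_iff[of a b "\<lambda>t. u t * u t"] \<open>a < b\<close> by simp
  then show ?thesis using \<open>t \<in> {a..b}\<close> by simp
qed

text \<open>Powers of a real t are real, so the moments of the real and imaginary parts vanish
  separately.\<close>

lemma vanishing_moments_imp_zero:
  fixes w :: "real \<Rightarrow> complex"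
  assumes w: "continuous_on {a..b} w" and "a < b"
    and mom: "\<And>k. integral {a..b} (\<lambda>t. of_real t ^ k * w t) = 0" and t: "t \<in> {a..b}"
  shows "w t = 0"
proof -
  have int: "((\<lambda>t. of_real t ^ k * w t) has_integral 0) {a..b}" for k
  proof -
    have "(\<lambda>t. of_real t ^ k * w t) integrable_on {a..b}"
      by (intro integrable_continuous_real continuous_intros w)
    then show ?thesis by (simp add: has_integral_iff mom)
  qed
  have "Re (w t) = 0"
  proof (rule vanishing_moments_imp_zero_real[OF _ \<open>a < b\<close> _ t])
    show "integral {a..b} (\<lambda>t. t ^ k * Re (w t)) = 0" for k
      using has_integral_linear[OF int bounded_linear_Re, of k]
      by (simp add: o_def integral_unique flip: of_real_power)
  qed (intro continuous_intros w)
  moreover have "Im (w t) = 0"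
  proof (rule vanishing_moments_imp_zero_real[OF _ \<open>a < b\<close> _ t])
    show "integral {a..b} (\<lambda>t. t ^ k * Im (w t)) = 0" for k
      using has_integral_linear[OF int bounded_linear_Im, of k]
      by (simp add: o_def integral_unique flip: of_real_power)
  qed (intro continuous_intros w)
  ultimately show ?thesis by (simp add: complex_eq_iff)
qed

section \<open>Pochhammer quotients as multipliers\<close>

text \<open>The integrand of Euler's beta integral B(a, c).\<close>

definition beta_weight :: "complex \<Rightarrow> complex \<Rightarrow> real \<Rightarrow> complex" where
  "beta_weight a c t = of_real t powr (a - 1) * of_real (1 - t) powr (c - 1)"

text \<open>Real parts above 1 make the weight tend to 0 at both endpoints, in agreement with
  \<open>0 powr z = 0\<close>. This gives continuity on the closed interval, as the moment lemmas
  require.\<close>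

lemma continuous_on_beta_weight:
  assumes "Re a > 1" "Re c > 1"
  shows "continuous_on {0..1} (beta_weight a c)"
  unfolding beta_weight_def using assms
  by (intro continuous_on_mult continuous_on_powr_complex continuous_intros)
    (auto simp: complex_nonpos_Reals_iff)

text \<open>Integration by parts: t^(a+k) (1-t)^c vanishes at 0 and 1, and its derivative is ((a+k)
  - (a+c+k) t) t^k times the weight.\<close>

lemma beta_moment_Suc:
  assumes "Re a > 1" "Re c > 1"
  defines "m \<equiv> \<lambda>k. integral {0..1} (\<lambda>t. of_real t ^ k * beta_weight a c t)"
  shows "(a + c + of_nat k) * m (Suc k) = (a + of_nat k) * m k"
proof -
  let ?h = "\<lambda>t. of_real t ^ k * (of_real t powr a * of_real (1 - t) powr c) :: complex"
  let ?h' = "\<lambda>t. (a + of_nat k) * (of_real t ^ k * beta_weight a c t)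
                - (a + c + of_nat k) * (of_real t ^ Suc k * beta_weight a c t)"
  have "(?h' has_integral (?h 1 - ?h 0)) {0..1}"
  proof (rule fundamental_theorem_of_calculus_interior)
    show "continuous_on {0..1} ?h" using assms
      by (intro continuous_on_mult continuous_on_powr_complex continuous_intros)
        (auto simp: complex_nonpos_Reals_iff)
    fix t :: real assume t: "t \<in> {0<..<1}"
    have "((\<lambda>z. z ^ k * (z powr a * (1 - z) powr c)) has_field_derivative ?h' t) (at (of_real t))"
    proof -
      have nz: "complex_of_real t \<noteq> 0" "1 - complex_of_real t \<noteq> 0" using t by auto
      have p: "of_real t powr a = of_real t * of_real t powr (a - 1)"
        "(1 - of_real t) powr c = (1 - of_real t) * (1 - of_real t) powr (c - 1)"
        using nz by (simp_all add: powr_diff)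
      \<comment> \<open>For k = 0 the exponent k - 1 is truncated, but the factor k makes both sides
        0.\<close>
      have q: "of_nat k * complex_of_real t ^ (k - 1) * of_real t = of_nat k * of_real t ^ k"
        by (cases k) auto
      have "((\<lambda>z. z ^ k * (z powr a * (1 - z) powr c)) has_field_derivative
         of_nat k * of_real t ^ (k - 1) * (of_real t powr a * (1 - of_real t) powr c) +
         of_real t ^ k * (a * of_real t powr (a - 1) * (1 - of_real t) powr c
           - of_real t powr a * (c * (1 - of_real t) powr (c - 1)))) (at (of_real t))"
        using t by (auto intro!: derivative_eq_intros simp: complex_nonpos_Reals_iff)
      also have "of_nat k * of_real t ^ (k - 1) * (of_real t powr a * (1 - of_real t) powr c) =
          (of_nat k * complex_of_real t ^ (k - 1) * of_real t) *
          (of_real t powr (a - 1) * (1 - of_real t) * (1 - of_real t) powr (c - 1))"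
        by (simp only: p mult_ac)
      finally show ?thesis
        unfolding q p by (simp add: beta_weight_def algebra_simps)
    qed
    from has_vector_derivative_real_field[OF this]
    show "(?h has_vector_derivative ?h' t) (at t)" by simp
  qed auto
  then have "(?h' has_integral 0) {0..1}" by simp
  moreover have "(?h' has_integral (a + of_nat k) * m k - (a + c + of_nat k) * m (Suc k)) {0..1}"
    unfolding m_def
    by (intro has_integral_diff has_integral_mult_right integrable_integral
        integrable_continuous_real continuous_intros continuous_on_beta_weight assms)
  ultimately have "(a + of_nat k) * m k - (a + c + of_nat k) * m (Suc k) = 0"
    by (rule has_integral_unique[symmetric])
  then show ?thesis by simp
qed

text \<open>Iterating the recursion gives the moments relative to the zeroth one. That constant is
  B(a, c); its value is never computed, only its nonvanishing is used.\<close>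

lemma beta_moment_eq:
  assumes "Re a > 1" "Re c > 1"
  shows "integral {0..1} (\<lambda>t. of_real t ^ k * beta_weight a c t) =
           integral {0..1} (beta_weight a c) * (pochhammer a k / pochhammer (a + c) k)"
proof (induction k)
  case (Suc k)
  have nz: "a + c + of_nat k \<noteq> 0" using assms by (auto simp: complex_eq_iff)
  have "integral {0..1} (\<lambda>t. of_real t ^ Suc k * beta_weight a c t) =
      (a + of_nat k) / (a + c + of_nat k) * integral {0..1} (\<lambda>t. of_real t ^ k * beta_weight a c t)"
    using beta_moment_Suc[OF assms, of k]
    by (simp only: times_divide_eq_left nonzero_eq_divide_eq[OF nz] mult.commute[of "a + c + of_nat k"])
  then show ?case
    by (simp only: Suc.IH pochhammer_rec' times_divide_times_eq times_divide_eq_left times_divide_eq_right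
        divide_divide_eq_left mult_ac)
qed simp

text \<open>If the zeroth moment were 0, all moments would be 0, and the weight would vanish
  identically, contrary to its value at 1/2.\<close>

lemma beta_integral_nonzero:
  assumes "Re a > 1" "Re c > 1"
  shows "integral {0..1} (beta_weight a c) \<noteq> 0"
proof
  assume "integral {0..1} (beta_weight a c) = 0"
  then have "beta_weight a c (1/2) = 0"
    by (intro vanishing_moments_imp_zero[OF continuous_on_beta_weight[OF assms]])
      (auto simp: beta_moment_eq[OF assms])
  then show False by (simp add: beta_weight_def)
qed

definition pochhammer_multiplier :: "complex \<Rightarrow> complex \<Rightarrow> complex fps \<Rightarrow> complex fps" where
  "pochhammer_multiplier a b F = Abs_fps (\<lambda>k. F $ k * (pochhammer a k / pochhammer b k))"

lemma slit_continuable_pochhammer_multiplier_integral: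
  assumes "Re a > 1" "Re (b - a) > 1" "slit_continuable F"
  shows "slit_continuable (pochhammer_multiplier a b F)"
proof -
  let ?I = "integral {0..1} (beta_weight a (b - a))"
  have "pochhammer_multiplier a b F = fps_const (1 / ?I) *
     Abs_fps (\<lambda>k. F $ k * integral {0..1} (\<lambda>t. of_real t ^ k * beta_weight a (b - a) t))"
    using beta_integral_nonzero[OF assms(1,2)]
    by (simp add: fps_eq_iff pochhammer_multiplier_def beta_moment_eq[OF assms(1,2)])
  then show ?thesis
    using assms by (auto intro!: slit_continuable_const_mult slit_continuable_moment_multiplier
        continuous_on_beta_weight)
qed

text \<open>Since (a)_k / (b)_k = ((k + b) / b) (a)_k / (b+1)_k, the Euler operator lowers the
  denominator parameter by one. Iteration reduces b to b + n, which enlarges Re (b - a).\<close>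

lemma slit_continuable_pochhammer_multiplier_lower:
  assumes "\<And>F. slit_continuable F \<Longrightarrow> slit_continuable (pochhammer_multiplier a (b + of_nat n) F)"
    and "b \<notin> \<int>\<^sub>\<le>\<^sub>0" "slit_continuable F"
  shows "slit_continuable (pochhammer_multiplier a b F)"
  using assms
proof (induction n arbitrary: b F)
  case (Suc n)
  have b: "b + of_nat k \<noteq> 0" for k
    using Suc.prems(2) by (metis add.inverse_inverse add_eq_0_iff2 minus_of_nat_in_nonpos_Ints)
  have b': "b + 1 \<notin> \<int>\<^sub>\<le>\<^sub>0"
    using Suc.prems(2) plus_one_in_nonpos_Ints_imp by blast
  have "pochhammer a k / pochhammer b k = (of_nat k + b) / b * (pochhammer a k / pochhammer (b + 1) k)" for k
  proof -
    have "b * pochhammer (b + 1) k = (b + of_nat k) * pochhammer b k"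
      by (metis pochhammer_rec pochhammer_rec')
    then have "pochhammer (b + 1) k = (b + of_nat k) * pochhammer b k / b"
      using b[of 0] by (simp add: field_simps)
    then show ?thesis using b[of k] b[of 0] by (simp add: add.commute)
  qed
  then have eq: "pochhammer_multiplier a b F =
      fps_const (1 / b) * Abs_fps (\<lambda>k. (of_nat k + b) * pochhammer_multiplier a (b + 1) F $ k)"
    by (simp add: fps_eq_iff pochhammer_multiplier_def)
  have "slit_continuable (pochhammer_multiplier a (b + 1) F)"
  proof (rule Suc.IH)
    show "slit_continuable (pochhammer_multiplier a (b + 1 + of_nat n) G)" if "slit_continuable G" for G
      using Suc.prems(1)[OF that] by (simp only: of_nat_Suc add.assoc)
  qed (fact b' Suc.prems(3))+
  then show ?case
    unfolding eq by (intro slit_continuable_const_mult slit_continuable_Euler_operator)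
qed simp

text \<open>Since (a)_(k+1) / (b)_(k+1) = (a / b) (a+1)_k / (b+1)_k, splitting off the constant term
  raises both parameters and keeps b - a. The series is shifted each time, so the assumption has to
  cover all F.\<close>

lemma slit_continuable_pochhammer_multiplier_shift:
  assumes "\<And>F. slit_continuable F \<Longrightarrow>
      slit_continuable (pochhammer_multiplier (a + of_nat n) (b + of_nat n) F)"
    and "slit_continuable F"
  shows "slit_continuable (pochhammer_multiplier a b F)"
  using assms
proof (induction n arbitrary: a b F)
  case (Suc n)
  have "slit_continuable (pochhammer_multiplier (a + 1) (b + 1) (fps_shift 1 F))"
  proof (rule Suc.IH)
    show "slit_continuable (pochhammer_multiplier (a + 1 + of_nat n) (b + 1 + of_nat n) G)"
      if "slit_continuable G" for G
      using Suc.prems(1)[OF that] by (simp only: of_nat_Suc add.assoc)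
  qed (intro slit_continuable_shift Suc.prems(2))
  then have "slit_continuable (fps_const (F $ 0) + fps_X *
      (fps_const (a / b) * pochhammer_multiplier (a + 1) (b + 1) (fps_shift 1 F)))"
    by (intro slit_continuable_unshift slit_continuable_const_mult)
  moreover have "pochhammer_multiplier a b F = fps_const (F $ 0) + fps_X *
      (fps_const (a / b) * pochhammer_multiplier (a + 1) (b + 1) (fps_shift 1 F))"
  proof (rule fps_ext)
    fix k
    show "pochhammer_multiplier a b F $ k = (fps_const (F $ 0) + fps_X *
      (fps_const (a / b) * pochhammer_multiplier (a + 1) (b + 1) (fps_shift 1 F))) $ k"
      by (cases k) (simp_all add: pochhammer_multiplier_def pochhammer_rec)
  qed
  ultimately show ?case by simp
qed simp

lemma slit_continuable_pochhammer_multiplier: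
  assumes "b \<notin> \<int>\<^sub>\<le>\<^sub>0" "slit_continuable F"
  shows "slit_continuable (pochhammer_multiplier a b F)"
proof -
  \<comment> \<open>The shift m gives Re (a + m) > 1 and Re (b + m) > 0; then n gives Re (b + n - a)
    > 1. These are the ranges for the integral representation and for the descent in the lower
    parameter.\<close>
  obtain m :: nat where m: "real m > max (1 - Re a) (- Re b)"
    using reals_Archimedean2 by blast
  obtain n :: nat where n: "real n > 1 - Re b + Re a"
    using reals_Archimedean2 by blast
  show ?thesis
  proof (rule slit_continuable_pochhammer_multiplier_shift[of a m])
    fix F assume "slit_continuable F"
    then show "slit_continuable (pochhammer_multiplier (a + of_nat m) (b + of_nat m) F)"
    proof (rule slit_continuable_pochhammer_multiplier_lower[of _ _ n, rotated 2])
      show "b + of_nat m \<notin> \<int>\<^sub>\<le>\<^sub>0"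
        using m by (auto elim!: nonpos_Ints_cases simp: complex_eq_iff)
    qed (use m n in \<open>auto intro!: slit_continuable_pochhammer_multiplier_integral\<close>)
  qed fact
qed

section \<open>Hypergeometric series\<close>

lemma foldr_pochhammer_eq_prod_list:
  fixes c :: "'a::comm_ring_1"
  shows "foldr (\<lambda>a r. r * pochhammer a n) xs c = prod_list (map (\<lambda>a. pochhammer a n) xs) * c"
  by (induction xs) simp_all

lemma fps_hypergeo_nth_prod_list:
  "fps_hypergeo as bs 1 $ n =
     prod_list (map (\<lambda>a. pochhammer a n) as) / (prod_list (map (\<lambda>b. pochhammer b n) bs) * fact n)"
  by (simp only: fps_hypergeo_nth_alt foldr_pochhammer_eq_prod_list power_one mult_1_right of_nat_fact)

text \<open>Each pair of an upper and a lower parameter is one multiplier. The upper parameter left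
  over is paired with k! = (1)_k and acts on the geometric series.\<close>

lemma slit_continuable_fps_hypergeo:
  assumes "length as = length bs + 1" "\<forall>b\<in>set bs. b \<notin> \<int>\<^sub>\<le>\<^sub>0"
  shows "slit_continuable (fps_hypergeo as bs 1)"
  using assms
proof (induction bs arbitrary: as)
  case Nil
  then obtain a where as: "as = [a]" by (auto simp: length_Suc_conv)
  have "fps_hypergeo as [] 1 = pochhammer_multiplier a 1 (Abs_fps (\<lambda>_. 1))"
    by (simp add: fps_eq_iff fps_hypergeo_nth_prod_list pochhammer_multiplier_def as
        pochhammer_fact del: fps_hypergeo_nth)
  then show ?case
    using slit_continuable_pochhammer_multiplier[OF _ slit_continuable_geometric, of 1 a] by simp
next
  case (Cons b bs)
  then obtain a as' where as: "as = a # as'" by (cases as) auto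
  have "fps_hypergeo as (b # bs) 1 = pochhammer_multiplier a b (fps_hypergeo as' bs 1)"
    by (simp add: fps_eq_iff fps_hypergeo_nth_prod_list pochhammer_multiplier_def as mult_ac
        del: fps_hypergeo_nth)
  then show ?case
    using slit_continuable_pochhammer_multiplier[OF _ Cons.IH, of b as' a] Cons.prems as by simp
qed

section \<open>Elementary symmetric polynomials and the coefficient comparison\<close>

lemma prod_list_add_eq_elem_sym:
  "prod_list (map (\<lambda>a. a + t) xs) = (\<Sum>k\<le>length xs. elem_sym k xs * t ^ (length xs - k))"
proof -
  let ?n = "length xs"
  have "prod_list (map (\<lambda>a. a + t) xs) = (\<Prod>i\<in>{..<?n}. xs ! i + t)"
    by (simp add: prod.list_conv_set_nth atLeast0LessThan)
  \<comment> \<open>The set I records the factors from which \<open>xs ! i\<close> is taken rather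
    than t; grouping by \<open>card I\<close> collects the powers of t.\<close>
  also have "\<dots> = (\<Sum>I\<in>Pow {..<?n}. (\<Prod>i\<in>I. xs ! i) * (\<Prod>i\<in>{..<?n} - I. t))"
    by (rule prod_add) simp
  also have "\<dots> = (\<Sum>k\<le>?n. \<Sum>I | I \<in> Pow {..<?n} \<and> card I = k.
      (\<Prod>i\<in>I. xs ! i) * (\<Prod>i\<in>{..<?n} - I. t))"
  proof (rule sum.group[symmetric])
    show "card ` Pow {..<?n} \<subseteq> {..?n}"
      using card_mono[of "{..<?n}"] by auto
  qed simp_all
  also have "\<dots> = (\<Sum>k\<le>?n. elem_sym k xs * t ^ (?n - k))"
  proof (rule sum.cong)
    fix k
    have "(\<Prod>i\<in>{..<?n} - I. t) = t ^ (?n - card I)" if "I \<subseteq> {..<?n}" for I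
      using that by (simp add: card_Diff_subset finite_subset)
    then show "(\<Sum>I | I \<in> Pow {..<?n} \<and> card I = k. (\<Prod>i\<in>I. xs ! i) * (\<Prod>i\<in>{..<?n} - I. t)) =
        elem_sym k xs * t ^ (?n - k)"
      by (auto simp add: elem_sym_def sum_distrib_right intro!: sum.cong)
  qed simp
  finally show ?thesis .
qed

text \<open>In the two expansions the terms of index 0 to r agree up to the factor t. Only the top
  symmetric polynomial of \<alpha> is left over, and t = 0 identifies it as the product.\<close>

lemma U_set_prod_list:
  assumes "(\<alpha>, \<beta>) \<in> U_set r"
  shows "prod_list (map (\<lambda>a. a + t) \<alpha>) = t * prod_list (map (\<lambda>b. b + t) \<beta>) + prod_list \<alpha>"
proof -
  have len: "length \<alpha> = Suc r" "length \<beta> = r"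
    and S: "\<And>k. 1 \<le> k \<Longrightarrow> k \<le> r \<Longrightarrow> elem_sym k \<alpha> = elem_sym k \<beta>"
    using assms by (auto simp: U_set_def)
  have S0: "elem_sym 0 xs = 1" for xs
  proof -
    have "{I. I \<subseteq> {..<length xs} \<and> card I = 0} = {{}}" by (auto dest: finite_subset)
    then show ?thesis by (simp add: elem_sym_def)
  qed
  have eq: "elem_sym k \<alpha> = elem_sym k \<beta>" if "k \<le> r" for k
    using S[of k] S0 that by (cases "k = 0") auto
  have *: "prod_list (map (\<lambda>a. a + t) \<alpha>) =
      t * prod_list (map (\<lambda>b. b + t) \<beta>) + elem_sym (Suc r) \<alpha>" for t
    unfolding prod_list_add_eq_elem_sym len
    by (auto simp: eq sum_distrib_left Suc_diff_le mult_ac intro!: sum.cong)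
  from *[of 0] have "prod_list \<alpha> = elem_sym (Suc r) \<alpha>" by simp
  with * show ?thesis by simp
qed

text \<open>Over a common denominator, the coefficient difference of index n + 1 and n on the right
  has numerator (P - (n+1) Q) A. By the product identity at t = n + 1 this is
  \<open>prod_list \<alpha> * A\<close>, the numerator on the left.\<close>

lemma fps_hypergeo_contiguity:
  assumes U: "(\<alpha>, \<beta>) \<in> U_set r" and b: "\<forall>b\<in>set \<beta>. b + 1 \<notin> \<int>\<^sub>\<le>\<^sub>0"
  shows "fps_hypergeo \<alpha> (map (\<lambda>b. b + 1) \<beta>) 1 =
           (1 - fps_X) * fps_hypergeo (map (\<lambda>a. a + 1) \<alpha>) (map (\<lambda>b. b + 1) \<beta>) 1"
    (is "?L = (1 - fps_X) * ?R")
proof (rule fps_ext)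
  fix k
  show "?L $ k = ((1 - fps_X) * ?R) $ k"
  proof (cases k)
    case 0
    then show ?thesis by (simp add: left_diff_distrib del: fps_hypergeo_nth)
  next
    case (Suc n)
    define A where "A = prod_list (map (\<lambda>a. pochhammer (a + 1) n) \<alpha>)"
    define B where "B = prod_list (map (\<lambda>b. pochhammer (b + 1) n) \<beta>)"
    \<comment> \<open>P and Q collect the last factors, \<alpha> + 1 + n and \<beta> + 1 + n, of the
      Pochhammer symbols of length n + 1.\<close>
    define P where "P = prod_list (map (\<lambda>a. a + of_nat (Suc n)) \<alpha>)"
    define Q where "Q = prod_list (map (\<lambda>b. b + of_nat (Suc n)) \<beta>)"
    have mult: "prod_list (map (\<lambda>x. f x * g x) xs) = prod_list (map f xs) * prod_list (map g xs)"
      for f g :: "complex \<Rightarrow> complex" and xs by (induction xs) auto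
    have step: "prod_list (map (\<lambda>x. pochhammer (x + 1) (Suc n)) xs) =
        prod_list (map (\<lambda>x. x + of_nat (Suc n)) xs) * prod_list (map (\<lambda>x. pochhammer (x + 1) n) xs)"
      for xs :: "complex list" by (simp add: pochhammer_rec' add_ac flip: mult)
    have low: "prod_list (map (\<lambda>a. pochhammer a (Suc n)) \<alpha>) = prod_list \<alpha> * A"
      by (simp add: pochhammer_rec mult A_def)
    have nz: "b + 1 + of_nat j \<noteq> 0" if "b \<in> set \<beta>" for b j
      using assms(2) that by (metis add.inverse_inverse add_eq_0_iff2 minus_of_nat_in_nonpos_Ints)
    have BQ: "B \<noteq> 0" "Q \<noteq> 0"
      using nz by (auto simp: B_def Q_def prod_list_zero_iff pochhammer_eq_0_iff add_ac
          eq_neg_iff_add_eq_0)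
    have P: "P = of_nat (Suc n) * Q + prod_list \<alpha>"
      unfolding P_def Q_def by (rule U_set_prod_list[OF U])
    have R: "?R $ Suc n = P * A / (Q * B * fact (Suc n))" "?R $ n = A / (B * fact n)"
      by (simp_all add: fps_hypergeo_nth_prod_list o_def step A_def B_def P_def Q_def
          del: fps_hypergeo_nth of_nat_Suc fact_Suc)
    have "?R $ n = of_nat (Suc n) * Q * A / (Q * B * fact (Suc n))"
      using BQ by (simp add: R(2) fact_Suc del: of_nat_Suc fps_hypergeo_nth)
    then have "((1 - fps_X) * ?R) $ k = (P - of_nat (Suc n) * Q) * A / (Q * B * fact (Suc n))"
      by (simp add: Suc R(1) left_diff_distrib diff_divide_distrib
          del: fps_hypergeo_nth of_nat_Suc fact_Suc)
    also have "\<dots> = prod_list \<alpha> * A / (Q * B * fact (Suc n))"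
      by (simp only: P add_diff_cancel_left')
    also have "\<dots> = ?L $ k"
      by (simp add: fps_hypergeo_nth_prod_list o_def step low B_def Q_def Suc
          del: fps_hypergeo_nth of_nat_Suc fact_Suc)
    finally show ?thesis ..
  qed
qed

theorem theorem2p1:
  fixes r :: nat and \<alpha> \<beta> :: "complex list" and x :: complex
  assumes "r \<ge> 1"
    and "(\<alpha>, \<beta>) \<in> U_set r"
    and "\<forall>b\<in>set \<beta>. b + 1 \<notin> \<int>\<^sub>\<le>\<^sub>0"
    and "x \<in> slit_plane"
  shows "hypergeo_F \<alpha> (map (\<lambda>b. b + 1) \<beta>) x =
         (1 - x) * hypergeo_F (map (\<lambda>a. a + 1) \<alpha>) (map (\<lambda>b. b + 1) \<beta>) x"
proof -
  \<comment> \<open>Only the right-hand series is continued by the multiplier argument; (1 - x) f(x)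
    then continues the left-hand one.\<close>
  have "slit_continuable (fps_hypergeo (map (\<lambda>a. a + 1) \<alpha>) (map (\<lambda>b. b + 1) \<beta>) 1)"
    using assms by (intro slit_continuable_fps_hypergeo) (auto simp: U_set_def)
  then obtain f where f: "f holomorphic_on slit_plane"
      "f has_fps_expansion fps_hypergeo (map (\<lambda>a. a + 1) \<alpha>) (map (\<lambda>b. b + 1) \<beta>) 1"
    unfolding slit_continuable_def by blast
  have "(\<lambda>x. (1 - x) * f x) holomorphic_on slit_plane"
    by (intro holomorphic_intros f)
  moreover have "(\<lambda>x. (1 - x) * f x) has_fps_expansion fps_hypergeo \<alpha> (map (\<lambda>b. b + 1) \<beta>) 1"
    unfolding fps_hypergeo_contiguity[OF assms(2,3)] by (intro fps_expansion_intros f)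
  ultimately show ?thesis
    using f assms(4) by (simp add: hypergeo_F_eqI)
qed

end
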